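(* Let $n\ge 5$. Consider the following $\mathbb{F}_q$-subspaces of $\mathbb{F}_{q^n}^2$: (1) $U_1=\{(\sum_{i=0}^{n-3}c_1x_ib_1^i+\alpha+\beta a_1,\ \alpha+\beta b_1) : x_i,\alpha,\beta\in\mathbb{F}_q\}$, with $a_1,b_1,c_1\in\mathbb{F}_{q^n}^*$ such that $\mathbb{F}_q(b_1)=\mathbb{F}_{q^n}$, $1\in c_1\langle 1,b_1,\ldots,b_1^{n-2}\rangle_{\mathbb{F}_q}$ and $a_1\notin c_1\langle 1,b_1,\ldots,b_1^{n-2}\rangle_{\mathbb{F}_q}$; (2) if $n=t(\ell+1)$ with $\ell$ a positive integer: $U_2=\{(\overline{s}+\sum_{i=0}^{t-3}c_2x_ib_2^i+\alpha+\beta a_2,\ \alpha+\beta b_2) : x_i,\alpha,\beta\in\mathbb{F}_q,\ \overline{s}\in\overline{S}\}$, with $a_2,b_2,c_2\in\mathbb{F}_{q^n}^*$ and $\overline{S}\subseteq\mathbb{F}_{q^n}$ such that $\mathbb{F}_q(b_2)=\mathbb{F}_{q^t}$ with $3\le t\le n-3$, $\overline{S}$ is an $\mathbb{F}_{q^t}$-subspace of $\mathbb{F}_{q^t}$-dimension $\ell$ with $c_2\mathbb{F}_{q^t}\cap\overline{S}=\{0\}$, $1\in\overline{S}\oplus c_2\langle 1,b_2,\ldots,b_2^{t-2}\rangle_{\mathbb{F}_q}$ and $a_2\notin\overline{S}\oplus c_2\langle 1,b_2,\ldots,b_2^{t-2}\rangle_{\mathbb{F}_q}$; (3) if $n$ is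 even: $U_3=\{(\sum_{i=0}^{n/2-2}c_3x_i\gamma^i+\alpha+\beta a_3,\ \alpha+\beta b_3) : x_i\in\mathbb{F}_{q^2},\ \alpha,\beta\in\mathbb{F}_q\}$, with $a_3,b_3,c_3,\gamma\in\mathbb{F}_{q^n}^*$ such that $\mathbb{F}_q(b_3)=\mathbb{F}_{q^2}$, $\mathbb{F}_{q^2}(\gamma)=\mathbb{F}_{q^n}$, $1\in c_3\langle 1,\gamma,\ldots,\gamma^{n/2-2}\rangle_{\mathbb{F}_{q^2}}$ and $a_3\notin c_3\langle 1,\gamma,\ldots,\gamma^{n/2-2}\rangle_{\mathbb{F}_{q^2}}$. Then for $i\neq j$ (whenever both are defined), $U_i$ and $U_j$ are $\Gamma\mathrm{L}(2,q^n)$-inequivalent.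
   Context: $q$ is a prime power. The group $\Gamma\mathrm{L}(2,q^n)$ acts on $\mathbb{F}_{q^n}^2$ by $v\mapsto Mv^\rho$ with $M\in\mathrm{GL}(2,q^n)$ and $\rho\in\mathrm{Aut}(\mathbb{F}_{q^n})$ applied entrywise; two $\mathbb{F}_q$-subspaces are $\Gamma\mathrm{L}(2,q^n)$-equivalent if one is mapped onto the other by such an element. *)

theory Defs
  imports "HOL-Analysis.Analysis" "HOL-Number_Theory.Prime_Powers"
begin

text \<open>
  The field of order \<open>q^n\<close> is a type \<open>'a\<close> of class \<open>{field, finite}\<close> with \<open>CARD('a) = q ^ n\<close>.
  Its subfields are sets over which linear algebra is done, so the scalars do not form a type
  and the spans and bases of the distribution (which have a type of scalars) do not apply.
\<close>

definition is_subfield :: "'a::field set \<Rightarrow> bool" where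
  "is_subfield K \<longleftrightarrow> 0 \<in> K \<and> 1 \<in> K \<and>
     (\<forall>x\<in>K. \<forall>y\<in>K. x + y \<in> K \<and> x * y \<in> K) \<and>
     (\<forall>x\<in>K. - x \<in> K \<and> inverse x \<in> K)"

definition adjoin :: "'a::field set \<Rightarrow> 'a \<Rightarrow> 'a set" where
  "adjoin K b = \<Inter>{L. is_subfield L \<and> K \<subseteq> L \<and> b \<in> L}"

definition span_over :: "'a::{field,finite} set \<Rightarrow> 'a set \<Rightarrow> 'a set" where
  "span_over K B = {\<Sum>v\<in>B. x v * v | x. \<forall>v\<in>B. x v \<in> K}"

definition indep_over :: "'a::{field,finite} set \<Rightarrow> 'a set \<Rightarrow> bool" where
  "indep_over K B \<longleftrightarrow>
     (\<forall>x. (\<forall>v\<in>B. x v \<in> K) \<and> (\<Sum>v\<in>B. x v * v) = 0 \<longrightarrow> (\<forall>v\<in>B. x v = 0))"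

definition subspace_over :: "'a::field set \<Rightarrow> 'a set \<Rightarrow> bool" where
  "subspace_over K S \<longleftrightarrow> 0 \<in> S \<and> (\<forall>v\<in>S. \<forall>w\<in>S. v + w \<in> S) \<and> (\<forall>k\<in>K. \<forall>v\<in>S. k * v \<in> S)"

definition has_dim_over :: "'a::{field,finite} set \<Rightarrow> 'a set \<Rightarrow> nat \<Rightarrow> bool" where
  "has_dim_over K S d \<longleftrightarrow> (\<exists>B. card B = d \<and> indep_over K B \<and> span_over K B = S)"

text \<open>\<open>scaled_power_span K c b m\<close> is \<open>c \<langle>1, b, \<dots>, b^m\<rangle>\<close>, the span being taken over \<open>K\<close>.\<close>

definition scaled_power_span :: "'a::{field,finite} set \<Rightarrow> 'a \<Rightarrow> 'a \<Rightarrow> nat \<Rightarrow> 'a set" where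
  "scaled_power_span K c b m = (*) c ` span_over K ((\<lambda>i. b ^ i) ` {0..m})"

definition field_aut :: "('a::field \<Rightarrow> 'a) \<Rightarrow> bool" where
  "field_aut \<rho> \<longleftrightarrow> bij \<rho> \<and> \<rho> 1 = 1 \<and>
     (\<forall>x y. \<rho> (x + y) = \<rho> x + \<rho> y) \<and> (\<forall>x y. \<rho> (x * y) = \<rho> x * \<rho> y)"

definition semilinear_map :: "'a::field^2^2 \<Rightarrow> ('a \<Rightarrow> 'a) \<Rightarrow> 'a^2 \<Rightarrow> 'a^2" where
  "semilinear_map M \<rho> v = M *v (\<chi> i. \<rho> (v $ i))"

definition GammaL_equiv :: "('a::field^2) set \<Rightarrow> ('a^2) set \<Rightarrow> bool" where
  "GammaL_equiv U W \<longleftrightarrow>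
     (\<exists>M \<rho>. invertible M \<and> field_aut \<rho> \<and> semilinear_map M \<rho> ` U = W)"

definition U1 :: "'a::{field,finite} set \<Rightarrow> nat \<Rightarrow> 'a \<Rightarrow> 'a \<Rightarrow> 'a \<Rightarrow> ('a^2) set" where
  "U1 Fq n a b c =
     {vector [(\<Sum>i=0..n-3. c * x i * b ^ i) + \<alpha> + \<beta> * a, \<alpha> + \<beta> * b] | x \<alpha> \<beta>.
        (\<forall>i\<in>{0..n-3}. x i \<in> Fq) \<and> \<alpha> \<in> Fq \<and> \<beta> \<in> Fq}"

definition admissible1 :: "'a::{field,finite} set \<Rightarrow> nat \<Rightarrow> 'a \<Rightarrow> 'a \<Rightarrow> 'a \<Rightarrow> bool" where
  "admissible1 Fq n a b c \<longleftrightarrow>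
     a \<noteq> 0 \<and> b \<noteq> 0 \<and> c \<noteq> 0 \<and>
     adjoin Fq b = UNIV \<and>
     1 \<in> scaled_power_span Fq c b (n - 2) \<and>
     a \<notin> scaled_power_span Fq c b (n - 2)"

definition U2 ::
  "'a::{field,finite} set \<Rightarrow> nat \<Rightarrow> 'a set \<Rightarrow> 'a \<Rightarrow> 'a \<Rightarrow> 'a \<Rightarrow> ('a^2) set" where
  "U2 Fq t S a b c =
     {vector [s + (\<Sum>i=0..t-3. c * x i * b ^ i) + \<alpha> + \<beta> * a, \<alpha> + \<beta> * b] | s x \<alpha> \<beta>.
        s \<in> S \<and> (\<forall>i\<in>{0..t-3}. x i \<in> Fq) \<and> \<alpha> \<in> Fq \<and> \<beta> \<in> Fq}"

text \<open>
  \<open>Ft\<close> is the subfield of order \<open>q ^ t\<close>. The condition \<open>(*) c ` Ft \<inter> S = {0}\<close> makes the sum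
  of \<open>S\<close> and the scaled span direct.
\<close>

definition admissible2 ::
  "'a::{field,finite} set \<Rightarrow> nat \<Rightarrow> nat \<Rightarrow> nat \<Rightarrow> nat \<Rightarrow> 'a set \<Rightarrow> 'a set \<Rightarrow> 'a \<Rightarrow> 'a \<Rightarrow> 'a \<Rightarrow> bool"
  where
  "admissible2 Fq q n t l Ft S a b c \<longleftrightarrow>
     l > 0 \<and> n = t * (l + 1) \<and> 3 \<le> t \<and> t \<le> n - 3 \<and>
     is_subfield Ft \<and> card Ft = q ^ t \<and>
     a \<noteq> 0 \<and> b \<noteq> 0 \<and> c \<noteq> 0 \<and>
     adjoin Fq b = Ft \<and>
     subspace_over Ft S \<and> has_dim_over Ft S l \<and>
     (*) c ` Ft \<inter> S = {0} \<and>
     1 \<in> {s + w | s w. s \<in> S \<and> w \<in> scaled_power_span Fq c b (t - 2)} \<and>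
     a \<notin> {s + w | s w. s \<in> S \<and> w \<in> scaled_power_span Fq c b (t - 2)}"

definition U3 ::
  "'a::{field,finite} set \<Rightarrow> 'a set \<Rightarrow> nat \<Rightarrow> 'a \<Rightarrow> 'a \<Rightarrow> 'a \<Rightarrow> 'a \<Rightarrow> ('a^2) set" where
  "U3 Fq Fq2 n a b c \<gamma> =
     {vector [(\<Sum>i=0..n div 2-2. c * x i * \<gamma> ^ i) + \<alpha> + \<beta> * a, \<alpha> + \<beta> * b] | x \<alpha> \<beta>.
        (\<forall>i\<in>{0..n div 2-2}. x i \<in> Fq2) \<and> \<alpha> \<in> Fq \<and> \<beta> \<in> Fq}"

text \<open>\<open>Fq2\<close> is the subfield of order \<open>q ^ 2\<close>.\<close>

definition admissible3 ::
  "'a::{field,finite} set \<Rightarrow> nat \<Rightarrow> nat \<Rightarrow> 'a set \<Rightarrow> 'a \<Rightarrow> 'a \<Rightarrow> 'a \<Rightarrow> 'a \<Rightarrow> bool" where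
  "admissible3 Fq q n Fq2 a b c \<gamma> \<longleftrightarrow>
     even n \<and>
     is_subfield Fq2 \<and> card Fq2 = q ^ 2 \<and>
     a \<noteq> 0 \<and> b \<noteq> 0 \<and> c \<noteq> 0 \<and> \<gamma> \<noteq> 0 \<and>
     adjoin Fq b = Fq2 \<and> adjoin Fq2 \<gamma> = UNIV \<and>
     1 \<in> scaled_power_span Fq2 c \<gamma> (n div 2 - 2) \<and>
     a \<notin> scaled_power_span Fq2 c \<gamma> (n div 2 - 2)"

lemma field_aut_inv:
  assumes "field_aut \<rho>"
  shows "field_aut (inv \<rho>)"
proof -
  have b: "bij \<rho>" and 1: "\<rho> 1 = 1"
    and add: "\<And>x y. \<rho> (x + y) = \<rho> x + \<rho> y" and mult: "\<And>x y. \<rho> (x * y) = \<rho> x * \<rho> y"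
    using assms by (auto simp: field_aut_def)
  have f: "\<rho> (inv \<rho> x) = x" and g: "inv \<rho> (\<rho> x) = x" for x
    using b by (auto simp: bij_is_inj bij_is_surj surj_f_inv_f)
  have "inv \<rho> 1 = 1" using g[of 1] 1 by simp
  moreover have "inv \<rho> (x + y) = inv \<rho> x + inv \<rho> y" for x y
    using g[of "inv \<rho> x + inv \<rho> y"] by (simp add: add f)
  moreover have "inv \<rho> (x * y) = inv \<rho> x * inv \<rho> y" for x y
    using g[of "inv \<rho> x * inv \<rho> y"] by (simp add: mult f)
  ultimately show ?thesis
    using b by (simp add: field_aut_def bij_imp_bij_inv)
qed

lemma GammaL_equiv_sym:
  assumes "GammaL_equiv U W"
  shows "GammaL_equiv W U"
proof -
  obtain M \<rho> where M: "invertible M" and \<rho>: "field_aut \<rho>" and W: "semilinear_map M \<rho> ` U = W"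
    using assms by (auto simp: GammaL_equiv_def)
  obtain N where NM: "N ** M = mat 1" and MN: "M ** N = mat 1"
    using M by (auto simp: invertible_def)
  define \<sigma> where "\<sigma> = inv \<rho>"
  have \<sigma>: "field_aut \<sigma>" using \<rho> by (simp add: \<sigma>_def field_aut_inv)
  have \<sigma>\<rho>: "\<sigma> (\<rho> x) = x" for x
    using \<rho> by (simp add: \<sigma>_def field_aut_def bij_is_inj)
  have add: "\<sigma> (x + y) = \<sigma> x + \<sigma> y" and mult: "\<sigma> (x * y) = \<sigma> x * \<sigma> y"
    and one: "\<sigma> 1 = 1" for x y
    using \<sigma> by (auto simp: field_aut_def)
  have zero: "\<sigma> 0 = 0" using add[of 0 0] by (metis add_cancel_left_right add_0)
  define m :: "'a^2^2 \<Rightarrow> 'a^2^2" where "m = (\<lambda>A. \<chi> i j. \<sigma> (A $ i $ j))"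
  have mm: "m (A ** B) = m A ** m B" for A B
    by (simp add: m_def vec_eq_iff matrix_matrix_mult_def sum_2 add mult)
  have m1: "m (mat 1) = mat 1"
    by (simp add: m_def vec_eq_iff mat_def zero one)
  have "invertible (m N)"
    unfolding invertible_def using mm[of M N] mm[of N M] by (metis NM MN m1)
  moreover have "semilinear_map (m N) \<sigma> (semilinear_map M \<rho> v) = v" for v
  proof -
    have "semilinear_map (m N) \<sigma> w = (\<chi> i. \<sigma> ((N *v w) $ i))" for w
      by (simp add: semilinear_map_def m_def vec_eq_iff matrix_vector_mult_def sum_2 add mult)
    then show ?thesis
      by (simp add: semilinear_map_def matrix_vector_mul_assoc NM \<sigma>\<rho>)
  qed
  then have "semilinear_map (m N) \<sigma> ` W = U"
    by (force simp: W[symmetric] image_image)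
  ultimately show ?thesis
    using \<sigma> by (auto simp: GammaL_equiv_def)
qed

end

theory Submission
  imports Defs
begin

text \<open>
  Each \<open>U\<^sub>i\<close> meets the axis spanned by \<open>(1, 0)\<close> in more than \<open>q^2\<close> vectors, while its
  second coordinates fill only the plane spanned by \<open>1, b\<^sub>i\<close> over \<open>F\<^sub>q\<close>. So a semilinear
  equivalence maps the axis to itself, and hence, up to a scalar, one plane into the other.
  The ratios of the elements of such a plane generate \<open>F\<^sub>q(b\<^sub>i)\<close>, so the orders \<open>q^n\<close>, \<open>q^t\<close>
  and \<open>q^2\<close> of these fields, which are distinct, separate the three families.
\<close>

section \<open>Subfields of a finite field and planes spanned by \<open>1\<close> and
  \<open>b\<close>\<close>

definition plane_over :: "'a::field set \<Rightarrow> 'a \<Rightarrow> 'a set" where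
  "plane_over K b = {x + y * b | x y. x \<in> K \<and> y \<in> K}"

lemma is_subfieldD:
  assumes "is_subfield K"
  shows "0 \<in> K" "1 \<in> K"
    and "\<And>x y. x \<in> K \<Longrightarrow> y \<in> K \<Longrightarrow> x + y \<in> K"
    and "\<And>x y. x \<in> K \<Longrightarrow> y \<in> K \<Longrightarrow> x * y \<in> K"
    and "\<And>x. x \<in> K \<Longrightarrow> - x \<in> K"
    and "\<And>x. x \<in> K \<Longrightarrow> inverse x \<in> K"
    and "\<And>x y. x \<in> K \<Longrightarrow> y \<in> K \<Longrightarrow> x - y \<in> K"
    and "\<And>x y. x \<in> K \<Longrightarrow> y \<in> K \<Longrightarrow> x / y \<in> K"
proof -
  show "0 \<in> K" "1 \<in> K" using assms by (auto simp: is_subfield_def)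
  show a: "\<And>x y. x \<in> K \<Longrightarrow> y \<in> K \<Longrightarrow> x + y \<in> K"
    and m: "\<And>x y. x \<in> K \<Longrightarrow> y \<in> K \<Longrightarrow> x * y \<in> K"
    and u: "\<And>x. x \<in> K \<Longrightarrow> - x \<in> K"
    and i: "\<And>x. x \<in> K \<Longrightarrow> inverse x \<in> K"
    using assms by (auto simp: is_subfield_def)
  show "\<And>x y. x \<in> K \<Longrightarrow> y \<in> K \<Longrightarrow> x - y \<in> K"
    by (metis a u diff_conv_add_uminus)
  show "\<And>x y. x \<in> K \<Longrightarrow> y \<in> K \<Longrightarrow> x / y \<in> K"
    by (metis m i divide_inverse)
qed

lemma is_subfield_adjoin: "is_subfield (adjoin K b)"
  unfolding is_subfield_def adjoin_def by auto

lemma adjoin_contains: "K \<subseteq> adjoin K b" "b \<in> adjoin K b"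
  by (auto simp: adjoin_def)

lemma adjoin_least: "is_subfield L \<Longrightarrow> K \<subseteq> L \<Longrightarrow> b \<in> L \<Longrightarrow> adjoin K b \<subseteq> L"
  by (auto simp: adjoin_def)

text \<open>Multiplication by a nonzero \<open>x\<close> is injective on the finite set
  \<open>L\<close>, hence onto \<open>L\<close>, so \<open>1\<close> is among its values.\<close>

lemma finite_subring_is_subfield:
  fixes L :: "'a::{field,finite} set"
  assumes "0 \<in> L" "1 \<in> L"
    and "\<And>x y. x \<in> L \<Longrightarrow> y \<in> L \<Longrightarrow> x + y \<in> L"
    and mult: "\<And>x y. x \<in> L \<Longrightarrow> y \<in> L \<Longrightarrow> x * y \<in> L"
    and "\<And>x. x \<in> L \<Longrightarrow> - x \<in> L"
  shows "is_subfield L"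
proof -
  have "inverse x \<in> L" if "x \<in> L" for x
  proof (cases "x = 0")
    case False
    have "(*) x ` L \<subseteq> L" using mult that by auto
    moreover have "inj_on ((*) x) L" using False by (auto intro: inj_onI)
    ultimately have "(*) x ` L = L" by (simp add: endo_inj_surj)
    then obtain y where "y \<in> L" "x * y = 1" using \<open>1 \<in> L\<close> by (metis imageE)
    then show ?thesis by (metis inverse_unique)
  qed (use \<open>0 \<in> L\<close> in simp)
  then show ?thesis using assms by (simp add: is_subfield_def)
qed

lemma card_plane_over_le:
  fixes K :: "'a::{field,finite} set"
  shows "card (plane_over K b) \<le> card K ^ 2"
proof -
  have "plane_over K b = (\<lambda>(x, y). x + y * b) ` (K \<times> K)"
    by (auto simp: plane_over_def)
  then have "card (plane_over K b) \<le> card (K \<times> K)" by (metis card_image_le finite)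
  then show ?thesis by (simp add: card_cartesian_product power2_eq_square)
qed

lemma plane_over_subset_adjoin: "plane_over K b \<subseteq> adjoin K b"
  using adjoin_contains[where K = K and b = b] is_subfieldD(3,4)[OF is_subfield_adjoin[of K b]]
  unfolding plane_over_def by blast

lemma contained_in_plane_over:
  assumes "is_subfield K"
  shows "K \<subseteq> plane_over K b" "b \<in> plane_over K b"
proof -
  show "K \<subseteq> plane_over K b"
  proof
    fix x assume "x \<in> K"
    then show "x \<in> plane_over K b"
      unfolding plane_over_def using is_subfieldD(1)[OF assms]
      by (intro CollectI exI[of _ x] exI[of _ 0]) auto
  qed
  show "b \<in> plane_over K b"
    unfolding plane_over_def using is_subfieldD(1,2)[OF assms]
    by (intro CollectI exI[of _ 0] exI[of _ 1]) auto
qed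

text \<open>A quadratic relation for \<open>b\<close> reduces products of plane elements back into
  the plane, which is therefore a field containing \<open>K\<close> and \<open>b\<close>. It is
  applied in contrapositive form: if \<open>adjoin K b\<close> is too large, then
  \<open>b\<^sup>2\<close> lies outside the plane.\<close>

lemma card_adjoin_quadratic_le:
  fixes K :: "'a::{field,finite} set"
  assumes K: "is_subfield K" and b: "b\<^sup>2 \<in> plane_over K b"
  shows "card (adjoin K b) \<le> card K ^ 2"
proof -
  note KD = is_subfieldD[OF K]
  obtain p r where pr: "p \<in> K" "r \<in> K" "b * b = p + r * b"
    using b by (auto simp: plane_over_def power2_eq_square)
  have "is_subfield (plane_over K b)"
  proof (rule finite_subring_is_subfield)
    show "0 \<in> plane_over K b" "1 \<in> plane_over K b"
      using contained_in_plane_over(1)[OF K] KD(1,2) by blast+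
  next
    fix u v assume "u \<in> plane_over K b" "v \<in> plane_over K b"
    then obtain x y x' y' where uv: "u = x + y * b" "v = x' + y' * b"
      and mem: "x \<in> K" "y \<in> K" "x' \<in> K" "y' \<in> K"
      by (auto simp: plane_over_def)
    have "u + v = (x + x') + (y + y') * b" by (simp add: uv algebra_simps)
    then show "u + v \<in> plane_over K b" using mem KD(3) by (auto simp: plane_over_def)
    have "u * v = x * x' + (x * y' + y * x') * b + y * y' * (b * b)"
      by (simp add: uv algebra_simps)
    also have "\<dots> = (x * x' + y * y' * p) + (x * y' + y * x' + y * y' * r) * b"
      unfolding pr(3) by (simp add: algebra_simps)
    finally show "u * v \<in> plane_over K b"
      unfolding plane_over_def using mem pr(1,2) KD(3,4)
      by (intro CollectI exI conjI) (rule refl | simp)+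
    have "- u = - x + (- y) * b" by (simp add: uv)
    then show "- u \<in> plane_over K b"
      unfolding plane_over_def using mem KD(5) by blast
  qed
  then have "adjoin K b \<subseteq> plane_over K b"
    using contained_in_plane_over[OF K] by (simp add: adjoin_least)
  then have "card (adjoin K b) \<le> card (plane_over K b)" by (simp add: card_mono)
  then show ?thesis using card_plane_over_le[of K b] by linarith
qed

text \<open>This is the independence of \<open>1\<close>, \<open>b\<close>, \<open>b\<^sup>2\<close>
  over \<open>K\<close> when \<open>b\<close> has degree above two; it supplies
  \<open>card K ^ 3\<close> distinct elements.\<close>

lemma inj_on_quadratic_combination:
  fixes K :: "'a::{field,finite} set"
  assumes K: "is_subfield K" and big: "card K ^ 2 < card (adjoin K b)"
  shows "inj_on (\<lambda>(x, y, z). x + y * b + z * b\<^sup>2) (K \<times> K \<times> K)"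
proof -
  note KD = is_subfieldD[OF K]
  have not_quad: "b\<^sup>2 \<notin> plane_over K b"
    using card_adjoin_quadratic_le[OF K, of b] big by linarith
  have no_rel: "x = 0 \<and> y = 0 \<and> z = 0"
    if mem: "x \<in> K" "y \<in> K" "z \<in> K" and rel: "x + y * b + z * b\<^sup>2 = 0" for x y z
  proof (cases "z = 0")
    case True
    \<comment> \<open>Otherwise \<open>b * b\<close> would lie in \<open>K\<close>, which is part of
      the plane.\<close>
    have "b \<notin> K"
      using not_quad contained_in_plane_over(1)[OF K] KD(4)[of b b]
      by (auto simp: power2_eq_square)
    moreover have "b = - x / y" if "y \<noteq> 0"
    proof -
      have "b * y = - x" using rel True by (simp add: eq_neg_iff_add_eq_0 add.commute mult.commute)
      then show ?thesis using that by (metis nonzero_eq_divide_eq)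
    qed
    ultimately have "y = 0" using mem KD(5,8) by metis
    then show ?thesis using rel True by simp
  next
    case False
    have "z * b\<^sup>2 = - (x + y * b)" using rel by (metis add.commute eq_neg_iff_add_eq_0)
    then have "b\<^sup>2 * z = - x - y * b" by (simp add: mult.commute)
    then have "b\<^sup>2 = (- x - y * b) / z" using False by (simp add: nonzero_eq_divide_eq)
    then have "b\<^sup>2 = - x / z + (- y / z) * b" by (simp add: diff_divide_distrib)
    then have "b\<^sup>2 \<in> plane_over K b" unfolding plane_over_def using mem KD(5,8) by blast
    then show ?thesis using not_quad by simp
  qed
  show ?thesis
  proof (rule inj_onI)
    fix p p'
    assume "p \<in> K \<times> K \<times> K" "p' \<in> K \<times> K \<times> K"
      and eq: "(\<lambda>(x, y, z). x + y * b + z * b\<^sup>2) p = (\<lambda>(x, y, z). x + y * b + z * b\<^sup>2) p'"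
    then obtain x y z x' y' z' where p: "p = (x, y, z)" "p' = (x', y', z')"
      and mem: "x \<in> K" "y \<in> K" "z \<in> K" "x' \<in> K" "y' \<in> K" "z' \<in> K" by auto
    \<comment> \<open>Two triples with equal images give a vanishing combination whose coefficients
      are their differences.\<close>
    have "x - x' = 0 \<and> y - y' = 0 \<and> z - z' = 0"
      using eq mem by (intro no_rel) (simp_all add: p KD(7) algebra_simps)
    then show "p = p'" by (simp add: p)
  qed
qed

section \<open>Semilinear equivalences and the size of the adjoined fields\<close>

lemma is_subfield_vimage:
  assumes "field_aut \<rho>" and L: "is_subfield L"
  shows "is_subfield (\<rho> -` L)"
proof -
  have inj: "inj \<rho>" and one: "\<rho> 1 = 1" and add: "\<And>x y. \<rho> (x + y) = \<rho> x + \<rho> y"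
    and mult: "\<And>x y. \<rho> (x * y) = \<rho> x * \<rho> y"
    using assms(1) by (auto simp: field_aut_def bij_is_inj)
  have zero: "\<rho> 0 = 0" using add[of 0 0] by (metis add_0 add_cancel_left_right)
  have neg: "\<rho> (- x) = - \<rho> x" for x
    using add[of x "- x"] by (simp add: zero eq_neg_iff_add_eq_0 add.commute)
  have inv: "\<rho> (inverse x) = inverse (\<rho> x)" for x
  proof (cases "x = 0")
    case False
    then have "\<rho> x * \<rho> (inverse x) = 1" by (simp flip: mult add: one)
    then show ?thesis by (metis inverse_unique)
  qed (simp add: zero)
  show ?thesis
    unfolding is_subfield_def using is_subfieldD(1-6)[OF L]
    by (simp add: zero one add mult neg inv)
qed

text \<open>The roles are asymmetric: \<open>U\<close> must contain many axis vectors (first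
  coordinates \<open>W\<close>) and project onto the whole plane of \<open>b\<close>, while
  \<open>U'\<close> must only project into the plane of \<open>b'\<close>. Hence a one-sided
  inequality.\<close>

lemma GammaL_equiv_card_adjoin_le:
  fixes K :: "'a::{field,finite} set" and U U' :: "('a^2) set"
  assumes K: "is_subfield K"
    and axis: "\<And>w. w \<in> W \<Longrightarrow> vector [w, 0] \<in> U" and W: "card K ^ 2 < card W"
    and proj: "\<And>y. y \<in> plane_over K b \<Longrightarrow> \<exists>u. vector [u, y] \<in> U"
    and proj': "\<And>v. v \<in> U' \<Longrightarrow> v $ 2 \<in> plane_over K b'"
    and equiv: "GammaL_equiv U U'"
  shows "card (adjoin K b) \<le> card (adjoin K b')"
proof -
  obtain M \<rho> where M: "invertible M" and \<rho>: "field_aut \<rho>" and U': "semilinear_map M \<rho> ` U = U'"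
    using equiv by (auto simp: GammaL_equiv_def)
  have bij: "bij \<rho>" and inj: "inj \<rho>" and one: "\<rho> 1 = 1" and add: "\<And>x y. \<rho> (x + y) = \<rho> x + \<rho> y"
    using \<rho> by (auto simp: field_aut_def bij_is_inj)
  have zero: "\<rho> 0 = 0" using add[of 0 0] by (metis add_0 add_cancel_left_right)
  have img: "M $ 2 $ 1 * \<rho> x + M $ 2 $ 2 * \<rho> y \<in> plane_over K b'" if "vector [x, y] \<in> U" for x y
  proof -
    have "semilinear_map M \<rho> (vector [x, y]) $ 2 \<in> plane_over K b'"
      using proj' U' that by blast
    then show ?thesis
      by (simp add: semilinear_map_def matrix_vector_mult_def sum_2)
  qed
  \<comment> \<open>Otherwise the images of the axis vectors would have at least
    \<open>card W\<close> distinct second coordinates, too many for the plane of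
    \<open>b'\<close>.\<close>
  have M21: "M $ 2 $ 1 = 0"
  proof (rule ccontr)
    assume nz: "M $ 2 $ 1 \<noteq> 0"
    have "inj_on (\<lambda>w. M $ 2 $ 1 * \<rho> w) W"
      using nz by (intro inj_onI) (simp add: inj_eq[OF inj])
    moreover have "(\<lambda>w. M $ 2 $ 1 * \<rho> w) ` W \<subseteq> plane_over K b'"
    proof (rule image_subsetI)
      fix w assume "w \<in> W"
      then show "M $ 2 $ 1 * \<rho> w \<in> plane_over K b'" using img[OF axis, of w] by (simp add: zero)
    qed
    ultimately have "card W \<le> card (plane_over K b')" by (metis card_inj_on_le finite)
    then show False using W card_plane_over_le[of K b'] by linarith
  qed
  obtain N where "M ** N = mat 1" using M by (auto simp: invertible_def)
  then have "(M ** N) $ 2 $ 2 = 1" by (simp add: mat_def)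
  \<comment> \<open>With the lower left entry zero, the lower right entry of \<open>M ** N\<close>
    is \<open>M $ 2 $ 2 * N $ 2 $ 2\<close>.\<close>
  then have D: "M $ 2 $ 2 \<noteq> 0" by (auto simp: matrix_matrix_mult_def sum_2 M21)
  have sub: "is_subfield (\<rho> -` adjoin K b')"
    using is_subfield_vimage[OF \<rho> is_subfield_adjoin] .
  have scaled: "M $ 2 $ 2 * \<rho> y \<in> adjoin K b'" if "y \<in> plane_over K b" for y
    using proj[OF that] img plane_over_subset_adjoin[of K b'] by (fastforce simp: M21)
  \<comment> \<open>Taking \<open>y = 1\<close> puts the scalar \<open>M $ 2 $ 2\<close> itself into
    the field, so that it can be divided out.\<close>
  have "1 \<in> plane_over K b" using contained_in_plane_over(1)[OF K] is_subfieldD(2)[OF K] by blast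
  then have D': "M $ 2 $ 2 \<in> adjoin K b'" using scaled[of 1] by (simp add: one)
  have "plane_over K b \<subseteq> \<rho> -` adjoin K b'"
  proof
    fix y assume "y \<in> plane_over K b"
    then have "M $ 2 $ 2 * \<rho> y / M $ 2 $ 2 \<in> adjoin K b'"
      using is_subfieldD(8)[OF is_subfield_adjoin scaled D'] by simp
    then show "y \<in> \<rho> -` adjoin K b'" using D by simp
  qed
  \<comment> \<open>The preimage is a subfield, and it contains \<open>K\<close> and
    \<open>b\<close> because both lie in the plane; minimality of \<open>adjoin K b\<close>
    applies.\<close>
  then have "adjoin K b \<subseteq> \<rho> -` adjoin K b'"
    using contained_in_plane_over[OF K] by (intro adjoin_least[OF sub]) auto
  then have "card (adjoin K b) \<le> card (\<rho> -` adjoin K b')" by (simp add: card_mono)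
  also have "\<dots> = card (adjoin K b')" using bij by (simp add: card_vimage_inj bij_is_inj bij_is_surj)
  finally show ?thesis .
qed

text \<open>Since \<open>n - 3\<close> is at least 2, the exponents 0, 1 and 2 all occur in the sum,
  and \<open>\<alpha> = \<beta> = 0\<close> places \<open>c\<close> times every combination of
  \<open>1\<close>, \<open>b\<close>, \<open>b\<^sup>2\<close> on the axis.\<close>

lemma U1_card_adjoin_le:
  fixes Fq :: "'a::{field,finite} set"
  assumes Fq: "is_subfield Fq" and n: "n \<ge> 5" and c: "c \<noteq> 0"
    and gt1: "1 < card Fq" and big: "card Fq ^ 2 < card (adjoin Fq b)"
    and proj': "\<And>v. v \<in> U' \<Longrightarrow> v $ 2 \<in> plane_over Fq b'"
    and equiv: "GammaL_equiv (U1 Fq n a b c) U'"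
  shows "card (adjoin Fq b) \<le> card (adjoin Fq b')"
proof (rule GammaL_equiv_card_adjoin_le[OF Fq _ _ _ proj' equiv])
  define f where "f = (\<lambda>(x, y, z). x + y * b + z * b\<^sup>2)"
  let ?W = "(*) c ` f ` (Fq \<times> Fq \<times> Fq)"
  have "inj_on f (Fq \<times> Fq \<times> Fq)"
    unfolding f_def by (rule inj_on_quadratic_combination[OF Fq big])
  moreover have "inj_on ((*) c) (f ` (Fq \<times> Fq \<times> Fq))" using c by (auto intro: inj_onI)
  ultimately have "card ?W = card Fq ^ 3"
    by (simp add: card_image card_cartesian_product power3_eq_cube)
  then show "card Fq ^ 2 < card ?W" using gt1 by simp
next
  fix w assume "w \<in> (*) c ` (\<lambda>(x, y, z). x + y * b + z * b\<^sup>2) ` (Fq \<times> Fq \<times> Fq)"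
  then obtain x y z where w: "w = c * (x + y * b + z * b\<^sup>2)"
    and mem: "x \<in> Fq" "y \<in> Fq" "z \<in> Fq" by auto
  \<comment> \<open>The three coefficients are padded with zeros up to exponent
    \<open>n - 3\<close>.\<close>
  define X where "X = (\<lambda>i::nat. if i = 0 then x else if i = 1 then y else if i = 2 then z else 0)"
  have "(\<Sum>i=0..n-3. c * X i * b ^ i) = (\<Sum>i\<in>{0,1,2}. c * X i * b ^ i)"
    by (rule sum.mono_neutral_right) (use n in \<open>auto simp: X_def\<close>)
  also have "\<dots> = w" by (simp add: X_def w algebra_simps)
  finally have "vector [w, 0] = (vector [(\<Sum>i=0..n-3. c * X i * b ^ i) + 0 + 0 * a, 0 + 0 * b] :: 'a^2)"
    by simp
  moreover have "\<forall>i\<in>{0..n-3}. X i \<in> Fq" using mem is_subfieldD(1)[OF Fq] by (simp add: X_def)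
  ultimately show "vector [w, 0] \<in> U1 Fq n a b c"
    unfolding U1_def using is_subfieldD(1)[OF Fq] by blast
next
  fix y assume "y \<in> plane_over Fq b"
  then obtain \<alpha> \<beta> where "y = \<alpha> + \<beta> * b" "\<alpha> \<in> Fq" "\<beta> \<in> Fq" by (auto simp: plane_over_def)
  moreover obtain X where "\<forall>i\<in>{0..n-3}. X i \<in> Fq"
    using is_subfieldD(1)[OF Fq] that[of "\<lambda>_. 0"] by simp
  ultimately show "\<exists>u. vector [u, y] \<in> U1 Fq n a b c" unfolding U1_def by blast
qed

text \<open>For \<open>t = 3\<close> the power sum has only the exponent 0, so the axis vectors are
  taken from \<open>S\<close> instead: being nonzero, it contains a full line over
  \<open>Ft\<close>, with \<open>card Ft\<close> elements.\<close>

lemma U2_card_adjoin_le: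
  fixes Fq :: "'a::{field,finite} set"
  assumes Fq: "is_subfield Fq" and S: "subspace_over Ft S" "has_dim_over Ft S l" "l > 0"
    and Ft: "is_subfield Ft" "card Fq ^ 2 < card Ft"
    and proj': "\<And>v. v \<in> U' \<Longrightarrow> v $ 2 \<in> plane_over Fq b'"
    and equiv: "GammaL_equiv (U2 Fq t S a b c) U'"
  shows "card (adjoin Fq b) \<le> card (adjoin Fq b')"
proof (rule GammaL_equiv_card_adjoin_le[OF Fq _ _ _ proj' equiv])
  define X where "X = (\<lambda>_::nat. 0::'a)"
  have F0: "\<forall>i\<in>{0..t-3}. X i \<in> Fq" "0 \<in> Fq"
    using is_subfieldD(1)[OF Fq] by (simp_all add: X_def)
  obtain B where B: "card B = l" "indep_over Ft B" "span_over Ft B = S"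
    using S(2) by (auto simp: has_dim_over_def)
  then obtain v where v: "v \<in> B" using S(3) by fastforce
  \<comment> \<open>These indicator coefficients serve twice: they contradict independence if
    \<open>v = 0\<close>, and they show that \<open>v\<close> lies in the span
    \<open>S\<close>.\<close>
  have delta: "(\<Sum>u\<in>B. (if u = v then 1 else 0) * u) = v"
    using v by (simp add: if_distrib [of "\<lambda>x. x * _"] cong: if_cong)
  have Ft01: "\<forall>u\<in>B. (if u = v then 1 else 0) \<in> Ft" using is_subfieldD(1,2)[OF Ft(1)] by simp
  have "v \<noteq> 0"
  proof
    assume "v = 0"
    then have "(if v = v then 1 else 0) = (0::'a)"
      using B(2)[unfolded indep_over_def, rule_format, of "\<lambda>u. if u = v then 1 else 0" v]
        delta Ft01 v by simp
    then show False by simp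
  qed
  have "v \<in> span_over Ft B"
    unfolding span_over_def using delta Ft01
    by (intro CollectI exI[of _ "\<lambda>u. if u = v then 1 else 0"]) simp
  then have "(\<lambda>k. k * v) ` Ft \<subseteq> S" using S(1) B(3) by (auto simp: subspace_over_def)
  moreover have "inj_on (\<lambda>k. k * v) Ft" using \<open>v \<noteq> 0\<close> by (auto intro: inj_onI)
  ultimately have "card Ft \<le> card S" by (metis card_inj_on_le finite)
  then show "card Fq ^ 2 < card S" using Ft(2) by linarith
  show "vector [s, 0] \<in> U2 Fq t S a b c" if "s \<in> S" for s
  proof -
    have "vector [s, 0] =
        (vector [s + (\<Sum>i=0..t-3. c * X i * b ^ i) + 0 + 0 * a, 0 + 0 * b] :: 'a^2)"
      by (simp add: X_def)
    then show ?thesis unfolding U2_def using that F0 by blast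
  qed
  show "\<exists>u. vector [u, y] \<in> U2 Fq t S a b c" if "y \<in> plane_over Fq b" for y
  proof -
    obtain \<alpha> \<beta> where "y = \<alpha> + \<beta> * b" "\<alpha> \<in> Fq" "\<beta> \<in> Fq"
      using \<open>y \<in> plane_over Fq b\<close> unfolding plane_over_def by blast
    moreover have "0 \<in> S" using S(1) by (simp add: subspace_over_def)
    ultimately show ?thesis unfolding U2_def using F0(1) by blast
  qed
qed

section \<open>Second coordinates and separation of the three families\<close>

lemma U2_snd_in_plane: "v \<in> U2 Fq t S a b c \<Longrightarrow> v $ 2 \<in> plane_over Fq b"
  unfolding U2_def plane_over_def by fastforce

lemma U3_snd_in_plane: "v \<in> U3 Fq Fq2 n a b c \<gamma> \<Longrightarrow> v $ 2 \<in> plane_over Fq b"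
  unfolding U3_def plane_over_def by fastforce

text \<open>Each pair is oriented from the larger adjoined field to the smaller, so that an
  equivalence would contradict the inequality it forces; \<open>GammaL_equiv_sym\<close> covers the
  reverse order. As \<open>U3\<close> is always the target, it enters through
  \<open>U3_snd_in_plane\<close>.\<close>

theorem theorem4p4:
  fixes Fq :: "'a::{field,finite} set" and q n :: nat
  assumes "primepow q"
    and "n \<ge> 5"
    and "CARD('a) = q ^ n"
    and "is_subfield Fq" and "card Fq = q"
  shows "(\<forall>a1 b1 c1 t l Ft S a2 b2 c2.
            admissible1 Fq n a1 b1 c1 \<and> admissible2 Fq q n t l Ft S a2 b2 c2 \<longrightarrow>
            \<not> GammaL_equiv (U1 Fq n a1 b1 c1) (U2 Fq t S a2 b2 c2)) \<and>
         (\<forall>a1 b1 c1 Fq2 a3 b3 c3 \<gamma>.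
            admissible1 Fq n a1 b1 c1 \<and> admissible3 Fq q n Fq2 a3 b3 c3 \<gamma> \<longrightarrow>
            \<not> GammaL_equiv (U1 Fq n a1 b1 c1) (U3 Fq Fq2 n a3 b3 c3 \<gamma>)) \<and>
         (\<forall>t l Ft S a2 b2 c2 Fq2 a3 b3 c3 \<gamma>.
            admissible2 Fq q n t l Ft S a2 b2 c2 \<and> admissible3 Fq q n Fq2 a3 b3 c3 \<gamma> \<longrightarrow>
            \<not> GammaL_equiv (U2 Fq t S a2 b2 c2) (U3 Fq Fq2 n a3 b3 c3 \<gamma>))"
proof -
  have q: "1 < q" using assms(1) by (simp add: primepow_gt_Suc_0)
  have pow_less: "q ^ i < q ^ j" if "i < j" for i j using q that by simp
  have gt1: "1 < card Fq" using q assms(5) by simp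
  \<comment> \<open>Shared by both comparisons with \<open>U1\<close>: since \<open>b\<close>
    generates the whole field, the field adjoined on the target side must be as large.\<close>
  have from_U1: "q ^ n \<le> card (adjoin Fq b')"
    if "admissible1 Fq n a b c" "GammaL_equiv (U1 Fq n a b c) U'"
      "\<And>v. v \<in> U' \<Longrightarrow> v $ 2 \<in> plane_over Fq b'" for a b c b' U'
  proof -
    have "card (adjoin Fq b) = q ^ n" "c \<noteq> 0"
      using that(1) assms(3) by (simp_all add: admissible1_def)
    then show ?thesis
      using U1_card_adjoin_le[OF assms(4,2) _ gt1 _ that(3,2)] pow_less[of 2 n] assms(2,5) by simp
  qed
  have "\<not> GammaL_equiv (U1 Fq n a1 b1 c1) (U2 Fq t S a2 b2 c2)"
    if "admissible1 Fq n a1 b1 c1" "admissible2 Fq q n t l Ft S a2 b2 c2"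
    for a1 b1 c1 t l Ft S a2 b2 c2
  proof
    assume "GammaL_equiv (U1 Fq n a1 b1 c1) (U2 Fq t S a2 b2 c2)"
    then have "q ^ n \<le> card (adjoin Fq b2)" using from_U1[OF that(1)] U2_snd_in_plane by blast
    moreover have "card (adjoin Fq b2) = q ^ t" "t < n"
      using that(2) by (auto simp: admissible2_def)
    ultimately show False using pow_less[of t n] by simp
  qed
  moreover have "\<not> GammaL_equiv (U1 Fq n a1 b1 c1) (U3 Fq Fq2 n a3 b3 c3 \<gamma>)"
    if "admissible1 Fq n a1 b1 c1" "admissible3 Fq q n Fq2 a3 b3 c3 \<gamma>"
    for a1 b1 c1 Fq2 a3 b3 c3 \<gamma>
  proof
    assume "GammaL_equiv (U1 Fq n a1 b1 c1) (U3 Fq Fq2 n a3 b3 c3 \<gamma>)"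
    then have "q ^ n \<le> card (adjoin Fq b3)" using from_U1[OF that(1)] U3_snd_in_plane by blast
    moreover have "card (adjoin Fq b3) = q ^ 2" using that(2) by (simp add: admissible3_def)
    ultimately show False using pow_less[of 2 n] assms(2) by simp
  qed
  moreover have "\<not> GammaL_equiv (U2 Fq t S a2 b2 c2) (U3 Fq Fq2 n a3 b3 c3 \<gamma>)"
    if "admissible2 Fq q n t l Ft S a2 b2 c2" "admissible3 Fq q n Fq2 a3 b3 c3 \<gamma>"
    for t l Ft S a2 b2 c2 Fq2 a3 b3 c3 \<gamma>
  proof
    assume equiv: "GammaL_equiv (U2 Fq t S a2 b2 c2) (U3 Fq Fq2 n a3 b3 c3 \<gamma>)"
    have Ft: "l > 0" "3 \<le> t" "is_subfield Ft" "card Ft = q ^ t" "adjoin Fq b2 = Ft"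
      "subspace_over Ft S" "has_dim_over Ft S l"
      using that(1) by (simp_all add: admissible2_def)
    \<comment> \<open>The bound \<open>3 \<le> t\<close> acts twice: here it makes the axis part of
      \<open>U2\<close> large enough, and at the end it separates \<open>q ^ t\<close> from
      \<open>q ^ 2\<close>.\<close>
    have "card Fq ^ 2 < card Ft" using pow_less[of 2 t] Ft(2,4) assms(5) by simp
    then have "card (adjoin Fq b2) \<le> card (adjoin Fq b3)"
      by (rule U2_card_adjoin_le[OF assms(4) Ft(6,7,1,3) _ _ equiv]) (rule U3_snd_in_plane)
    moreover have "card (adjoin Fq b3) = q ^ 2" using that(2) by (simp add: admissible3_def)
    ultimately show False using pow_less[of 2 t] Ft(2,4,5) by simp
  qed
  ultimately show ?thesis by (intro conjI allI impI) (elim conjE, metis)+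
qed

end
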